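(* For every $n\in\mathbb{N}$, the element $1$ is a coloop and the element $2n+2$ is a loop of the Catalan matroid $\mathbf{C}_{n+1}$, and there are matroid isomorphisms $$DS_{2n}\cong \mathbf{C}_{n+1}\setminus(2n+2)\qquad\text{and}\qquad DS_{2n-1}\cong \mathbf{C}_{n+1}\setminus 1\setminus(2n+2).$$
   Context: Binomial coefficients satisfy $\binom{a}{b}=0$ if $b<0$ or $b>a$. For $d\in\mathbb{N}$, the Dehn--Sommerville matrix $M_d$ is the $(\lfloor d/2\rfloor+1)\times(d+1)$ rational matrix with rows indexed by $0\le i\le\lfloor d/2\rfloor$, columns indexed by $0\le j\le d$, and entries $(M_d)_{ij}=\binom{d+1-i}{d+1-j}-\binom{i}{d+1-j}$. Relabel the columns $1,\dots,d+1$. The Dehn--Sommerville matroid $DS_d$ is the matroid on $[d+1]$ whose bases are the sets $B$ of $\lfloor d/2\rfloor+1$ column labels whose corresponding maximal minor of $M_d$ is nonzero. A Dyck path of length $2m$ is a lattice path from $(0,0)$ to $(2m,0)$ with steps $(1,1)$ (upsteps) and $(1,-1)$ (downsteps), numbered $1,\dots,2m$, never going below the $x$-axis. The Catalan matroid $\mathbf{C}_m$ is the matroid on ground set $[2m]$ whose bases are the upstep sets of Dyck paths of length $2m$. For a matroid $M$ and element $e$, the deletion $M\setminus e$ is the matroid on $E-\{e\}$ whose bases are the bases of $M$ not containing $e$ if $e$ is not a coloop, and the sets $B-\{e\}$ for bases $B$ of $M$ if $e$ is a coloop (an element in every basis); a loop is an element in no basis. *)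

theory Defs
  imports Complex_Main "Jordan_Normal_Form.Determinant" "Jordan_Normal_Form.DL_Submatrix"
begin

section \<open>Finite matroids, given by their bases\<close>

definition basis_system :: "'a set \<Rightarrow> 'a set set \<Rightarrow> bool" where
  "basis_system E \<B> \<longleftrightarrow> finite E \<and> \<B> \<noteq> {} \<and> (\<forall>B\<in>\<B>. B \<subseteq> E) \<and>
     (\<forall>A\<in>\<B>. \<forall>B\<in>\<B>. \<forall>x\<in>A - B. \<exists>y\<in>B - A. insert y (A - {x}) \<in> \<B>)"

typedef 'a matroid = "{(E :: 'a set, \<B>). basis_system E \<B>}"
  by (rule exI[of _ "({}, {{}})"]) (simp add: basis_system_def)

setup_lifting type_definition_matroid

lift_definition ground :: "'a matroid \<Rightarrow> 'a set" is fst .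

lift_definition bases :: "'a matroid \<Rightarrow> 'a set set" is snd .

definition is_loop :: "'a matroid \<Rightarrow> 'a \<Rightarrow> bool" where
  "is_loop M e \<longleftrightarrow> e \<in> ground M \<and> (\<forall>B\<in>bases M. e \<notin> B)"

definition is_coloop :: "'a matroid \<Rightarrow> 'a \<Rightarrow> bool" where
  "is_coloop M e \<longleftrightarrow> e \<in> ground M \<and> (\<forall>B\<in>bases M. e \<in> B)"

definition matroid_iso :: "'a matroid \<Rightarrow> 'b matroid \<Rightarrow> bool" (infix "\<cong>\<^sub>M" 50) where
  "M \<cong>\<^sub>M N \<longleftrightarrow> (\<exists>\<phi>. bij_betw \<phi> (ground M) (ground N) \<and>
     (\<forall>B. B \<subseteq> ground M \<longrightarrow> (B \<in> bases M \<longleftrightarrow> \<phi> ` B \<in> bases N)))"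

lemma basis_systemI:
  assumes "finite E" "\<B> \<noteq> {}" "\<And>B. B \<in> \<B> \<Longrightarrow> B \<subseteq> E"
    "\<And>A B x. A \<in> \<B> \<Longrightarrow> B \<in> \<B> \<Longrightarrow> x \<in> A - B \<Longrightarrow> \<exists>y\<in>B - A. insert y (A - {x}) \<in> \<B>"
  shows "basis_system E \<B>"
  unfolding basis_system_def using assms by (intro conjI ballI)

lemma basis_systemD:
  assumes "basis_system E \<B>"
  shows "finite E" "\<B> \<noteq> {}" "B \<in> \<B> \<Longrightarrow> B \<subseteq> E"
    "A \<in> \<B> \<Longrightarrow> B \<in> \<B> \<Longrightarrow> x \<in> A - B \<Longrightarrow> \<exists>y\<in>B - A. insert y (A - {x}) \<in> \<B>"
proof -
  note * = assms[unfolded basis_system_def]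
  show "finite E" using * by (rule conjunct1)
  show "\<B> \<noteq> {}" using *[THEN conjunct2] by (rule conjunct1)
  show "B \<subseteq> E" if "B \<in> \<B>" using *[THEN conjunct2, THEN conjunct2, THEN conjunct1] that by (rule bspec)
  show "\<exists>y\<in>B - A. insert y (A - {x}) \<in> \<B>" if "A \<in> \<B>" "B \<in> \<B>" "x \<in> A - B"
    using *[THEN conjunct2, THEN conjunct2, THEN conjunct2] that by (iprover dest: bspec)
qed

lemma basis_system_remove_coloop:
  assumes M: "basis_system E \<B>" and e: "\<forall>B\<in>\<B>. e \<in> B"
  shows "basis_system (E - {e}) ((\<lambda>B. B - {e}) ` \<B>)"
proof (rule basis_systemI)
  show "finite (E - {e})" using basis_systemD(1)[OF M] by simp
  show "(\<lambda>B. B - {e}) ` \<B> \<noteq> {}" using basis_systemD(2)[OF M] by simp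
  show "B \<subseteq> E - {e}" if "B \<in> (\<lambda>B. B - {e}) ` \<B>" for B
    using that basis_systemD(3)[OF M] by blast
  fix A' B' x assume "A' \<in> (\<lambda>B. B - {e}) ` \<B>" "B' \<in> (\<lambda>B. B - {e}) ` \<B>" and x: "x \<in> A' - B'"
  then obtain A B where A: "A \<in> \<B>" "A' = A - {e}" and B: "B \<in> \<B>" "B' = B - {e}" by blast
  have "x \<in> A - B" using x A(2) B(2) by auto
  then obtain y where y: "y \<in> B - A" "insert y (A - {x}) \<in> \<B>"
    using basis_systemD(4)[OF M A(1) B(1)] by auto
  have ye: "y \<noteq> e" using y(1) e A(1) by auto
  have "insert y (A' - {x}) = insert y (A - {x}) - {e}" using ye A(2) by auto
  hence "insert y (A' - {x}) \<in> (\<lambda>B. B - {e}) ` \<B>" using y(2) by simp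
  moreover have "y \<in> B' - A'" using y(1) ye A(2) B(2) by simp
  ultimately show "\<exists>y\<in>B' - A'. insert y (A' - {x}) \<in> (\<lambda>B. B - {e}) ` \<B>" by (rule bexI)
qed

lemma basis_system_remove_noncoloop:
  assumes M: "basis_system E \<B>" and e: "\<not> (\<forall>B\<in>\<B>. e \<in> B)"
  shows "basis_system (E - {e}) {B \<in> \<B>. e \<notin> B}"
proof (rule basis_systemI)
  show "finite (E - {e})" using basis_systemD(1)[OF M] by simp
  show "{B \<in> \<B>. e \<notin> B} \<noteq> {}" using e by blast
  show "B \<subseteq> E - {e}" if "B \<in> {B \<in> \<B>. e \<notin> B}" for B
    using that basis_systemD(3)[OF M, of B] by auto
  fix A B x assume A: "A \<in> {B \<in> \<B>. e \<notin> B}" and B: "B \<in> {B \<in> \<B>. e \<notin> B}" and x: "x \<in> A - B"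
  obtain y where y: "y \<in> B - A" "insert y (A - {x}) \<in> \<B>"
    using basis_systemD(4)[OF M _ _ x] A B by auto
  have "insert y (A - {x}) \<in> {B \<in> \<B>. e \<notin> B}" using y A B by auto
  with y(1) show "\<exists>y\<in>B - A. insert y (A - {x}) \<in> {B \<in> \<B>. e \<notin> B}" by (rule bexI[rotated])
qed

lemma basis_system_deletion:
  "basis_system E \<B> \<Longrightarrow> basis_system (E - {e})
     (if \<forall>B\<in>\<B>. e \<in> B then (\<lambda>B. B - {e}) ` \<B> else {B \<in> \<B>. e \<notin> B})"
  by (rule if_split[where P = "basis_system (E - {e})", THEN iffD2], intro conjI impI)
    (rule basis_system_remove_coloop basis_system_remove_noncoloop; assumption)+

lift_definition deletion :: "'a matroid \<Rightarrow> 'a \<Rightarrow> 'a matroid" is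
  "\<lambda>(E, \<B>) e. (E - {e}, if \<forall>B\<in>\<B>. e \<in> B then (\<lambda>B. B - {e}) ` \<B> else {B \<in> \<B>. e \<notin> B})"
  by (simp only: split_beta mem_Collect_eq fst_conv snd_conv basis_system_deletion)

lemma basis_system_matroid: "basis_system (ground M) (bases M)"
  by transfer (simp only: split_beta mem_Collect_eq)

lemma ground_deletion: "ground (deletion M e) = ground M - {e}"
  by transfer (simp only: split_beta fst_conv)

lemma bases_deletion:
  "bases (deletion M e) =
     (if is_coloop M e then (\<lambda>B. B - {e}) ` bases M else {B \<in> bases M. e \<notin> B})"
proof -
  have "is_coloop M e \<longleftrightarrow> (\<forall>B\<in>bases M. e \<in> B)"
    using basis_systemD(2,3)[OF basis_system_matroid[of M]] unfolding is_coloop_def by blast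
  moreover have "bases (deletion M e) =
      (if \<forall>B\<in>bases M. e \<in> B then (\<lambda>B. B - {e}) ` bases M else {B \<in> bases M. e \<notin> B})"
    by transfer (simp only: split_beta snd_conv)
  ultimately show ?thesis by (simp only:)
qed

section \<open>The Dehn--Sommerville matroid\<close>

text \<open>In \<open>DS_matrix\<close> the natural-number subtractions do not truncate, and \<open>choose\<close> vanishes when
  its lower argument exceeds the upper one, as required.\<close>

definition DS_matrix :: "nat \<Rightarrow> rat mat" where
  "DS_matrix d = mat (d div 2 + 1) (d + 1)
     (\<lambda>(i, j). of_nat ((d + 1 - i) choose (d + 1 - j)) - of_nat (i choose (d + 1 - j)))"

text \<open>Matrix columns are indexed from \<open>0\<close>, so the column labelled \<open>b\<close> has index \<open>b - 1\<close>.\<close>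

definition DS_bases :: "nat \<Rightarrow> nat set set" where
  "DS_bases d = {B. B \<subseteq> {1..d + 1} \<and> card B = d div 2 + 1 \<and>
     det (submatrix (DS_matrix d) UNIV ((\<lambda>b. b - 1) ` B)) \<noteq> 0}"

context
  fixes A :: "rat mat" and J :: "nat set" and k n :: nat
  assumes A: "A \<in> carrier_mat k n" and J: "J \<subseteq> {..<n}" and cardJ: "card J = k"
begin

lemma maximal_submatrix_carrier: "submatrix A UNIV J \<in> carrier_mat k k"
proof -
  have "{j. j < n \<and> j \<in> J} = J" using J by auto
  thus ?thesis using A cardJ by (auto simp: submatrix_def)
qed

lemma finite_columns: "finite J"
  using J finite_subset by blast

lemma pick_image: "pick J ` {..<k} = J"
proof
  show "pick J ` {..<k} \<subseteq> J" using cardJ pick_in_set_le by auto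
  show "J \<subseteq> pick J ` {..<k}"
  proof
    fix j assume j: "j \<in> J"
    have "{a \<in> J. a < j} \<subset> J" using j by auto
    hence "card {a \<in> J. a < j} < k" using cardJ finite_columns psubset_card_mono by metis
    thus "j \<in> pick J ` {..<k}" using pick_card_in_set[OF j] by force
  qed
qed

lemma col_maximal_submatrix:
  assumes "i < k" shows "col (submatrix A UNIV J) i = col A (pick J i)"
proof -
  have J': "{j. j < n \<and> j \<in> J} = J" using J by auto
  have "pick J i < n" using pick_image J assms by auto
  thus ?thesis using A cardJ assms
    by (intro eq_vecI) (auto simp: submatrix_def J' pick_UNIV)
qed

lemma det_maximal_submatrix_nonzero_iff:
  "det (submatrix A UNIV J) \<noteq> 0 \<longleftrightarrow>
     (\<forall>v\<in>carrier_vec k. (\<forall>j\<in>J. col A j \<bullet> v = 0) \<longrightarrow> v = 0\<^sub>v k)"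
proof -
  let ?S = "submatrix A UNIV J"
  note S = maximal_submatrix_carrier
  have *: "transpose_mat ?S *\<^sub>v v = 0\<^sub>v k \<longleftrightarrow> (\<forall>j\<in>J. col A j \<bullet> v = 0)" for v
  proof -
    have "transpose_mat ?S *\<^sub>v v = 0\<^sub>v k \<longleftrightarrow> (\<forall>i<k. col A (pick J i) \<bullet> v = 0)"
      using S by (auto simp: vec_eq_iff col_maximal_submatrix)
    also have "\<dots> \<longleftrightarrow> (\<forall>j\<in>pick J ` {..<k}. col A j \<bullet> v = 0)" by auto
    finally show ?thesis by (simp only: pick_image)
  qed
  have "det ?S = det (transpose_mat ?S)" using det_transpose[OF S] by simp
  thus ?thesis using S det_0_iff_vec_prod_zero[of "transpose_mat ?S" k] by (auto simp: *)
qed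

lemma ex_dual_vector:
  assumes det: "det (submatrix A UNIV J) \<noteq> 0" and x: "x \<in> J"
  obtains w where "w \<in> carrier_vec k" "col A x \<bullet> w \<noteq> 0" "\<forall>j\<in>J - {x}. col A j \<bullet> w = 0"
proof -
  let ?T = "transpose_mat (submatrix A UNIV J)"
  have T: "?T \<in> carrier_mat k k" using maximal_submatrix_carrier by auto
  have detT: "det ?T \<noteq> 0" using det det_transpose[OF maximal_submatrix_carrier] by simp
  obtain i where i: "i < k" "x = pick J i" using x pick_image by auto
  define w where "w = adj_mat ?T *\<^sub>v unit_vec k i"
  have adj: "adj_mat ?T \<in> carrier_mat k k" using adj_mat(1)[OF T] .
  have w: "w \<in> carrier_vec k" unfolding w_def using adj by auto
  have "?T *\<^sub>v w = (?T * adj_mat ?T) *\<^sub>v unit_vec k i"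
    unfolding w_def using T adj by simp
  also have "?T * adj_mat ?T = det ?T \<cdot>\<^sub>m 1\<^sub>m k" using adj_mat(2)[OF T] .
  also have "\<dots> *\<^sub>v unit_vec k i = det ?T \<cdot>\<^sub>v unit_vec k i"
    using i by (intro eq_vecI) auto
  finally have eq: "?T *\<^sub>v w = det ?T \<cdot>\<^sub>v unit_vec k i" .
  have ip: "col A (pick J l) \<bullet> w = (if l = i then det ?T else 0)" if "l < k" for l
  proof -
    have "col A (pick J l) \<bullet> w = (?T *\<^sub>v w) $ l"
      using that maximal_submatrix_carrier by (simp add: col_maximal_submatrix)
    also have "\<dots> = (if l = i then det ?T else 0)" using eq that i by simp
    finally show ?thesis .
  qed
  show thesis
  proof (rule that[OF w])
    show "col A x \<bullet> w \<noteq> 0" using ip i detT by simp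
    show "\<forall>j\<in>J - {x}. col A j \<bullet> w = 0"
    proof
      fix j assume j: "j \<in> J - {x}"
      then obtain l where "l < k" "j = pick J l" using pick_image by auto
      thus "col A j \<bullet> w = 0" using ip j i by auto
    qed
  qed
qed

end

lemma card_exchange:
  assumes "finite I" "x \<in> I" "y \<notin> I"
  shows "card (insert y (I - {x})) = card I"
proof -
  have "card (insert y (I - {x})) = Suc (card (I - {x}))" using assms by simp
  thus ?thesis using card.remove[OF assms(1,2)] by simp
qed

lemma maximal_minor_exchange:
  fixes A :: "rat mat"
  assumes A: "A \<in> carrier_mat k n"
    and I: "I \<subseteq> {..<n}" "card I = k" "det (submatrix A UNIV I) \<noteq> 0"
    and J: "J \<subseteq> {..<n}" "card J = k" "det (submatrix A UNIV J) \<noteq> 0"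
    and x: "x \<in> I - J"
  shows "\<exists>y\<in>J - I. det (submatrix A UNIV (insert y (I - {x}))) \<noteq> 0"
proof -
  have xI: "x \<in> I" using x by simp
  obtain w where w: "w \<in> carrier_vec k" "col A x \<bullet> w \<noteq> 0" "\<forall>j\<in>I - {x}. col A j \<bullet> w = 0"
    using ex_dual_vector[OF A I xI] by blast
  have col: "col A j \<in> carrier_vec k" for j using A by auto
  have w0: "w \<noteq> 0\<^sub>v k" using w(2) col[of x] by auto
  obtain y where y: "y \<in> J" "col A y \<bullet> w \<noteq> 0"
    using det_maximal_submatrix_nonzero_iff[OF A J(1,2)] J(3) w(1) w0 by blast
  have yx: "y \<in> J - I" using y w(3) x by auto
  let ?K = "insert y (I - {x})"
  have finI: "finite I" using I(1) finite_subset by blast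
  have K: "?K \<subseteq> {..<n}" using I(1) J(1) y by auto
  have k: "card ?K = k" using card_exchange[OF finI xI] yx I(2) by simp
  have "v = 0\<^sub>v k" if v: "v \<in> carrier_vec k" and orth: "\<forall>j\<in>?K. col A j \<bullet> v = 0" for v
  proof -
    define c where "c = (col A x \<bullet> v) / (col A x \<bullet> w)"
    have ip: "col A j \<bullet> (v - c \<cdot>\<^sub>v w) = col A j \<bullet> v - c * (col A j \<bullet> w)" for j
      using col[of j] v w(1) by (simp add: scalar_prod_minus_distrib)
    have u: "v - c \<cdot>\<^sub>v w \<in> carrier_vec k" using v w(1) by auto
    have "\<forall>j\<in>I. col A j \<bullet> (v - c \<cdot>\<^sub>v w) = 0"
    proof
      fix j assume "j \<in> I"
      thus "col A j \<bullet> (v - c \<cdot>\<^sub>v w) = 0"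
        unfolding ip using w orth by (cases "j = x") (auto simp: c_def)
    qed
    hence z: "v - c \<cdot>\<^sub>v w = 0\<^sub>v k"
      using det_maximal_submatrix_nonzero_iff[OF A I(1,2)] I(3) u by blast
    have "col A y \<bullet> v - c * (col A y \<bullet> w) = 0" using ip[of y] z col[of y] by simp
    hence "c = 0" using orth y by simp
    hence "v $ i = 0" if "i < k" for i
      using arg_cong[OF z, of "\<lambda>u. u $ i"] that v w(1) by simp
    thus ?thesis using v by (intro eq_vecI) auto
  qed
  hence "det (submatrix A UNIV ?K) \<noteq> 0"
    using det_maximal_submatrix_nonzero_iff[OF A K k] by blast
  thus ?thesis using yx by blast
qed

lemma DS_matrix_carrier: "DS_matrix d \<in> carrier_mat (d div 2 + 1) (d + 1)"
  by (simp add: DS_matrix_def)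

lemma DS_bases_exchange:
  assumes B: "B \<in> DS_bases d" and C: "C \<in> DS_bases d" and x: "x \<in> B - C"
  shows "\<exists>y\<in>C - B. insert y (B - {x}) \<in> DS_bases d"
proof -
  let ?p = "\<lambda>b :: nat. b - 1"
  have inj: "inj_on ?p {1..d + 1}" by (auto intro!: inj_onI)
  have sub: "?p ` X \<subseteq> {..<d + 1}" if "X \<subseteq> {1..d + 1}" for X using that by force
  have card: "card (?p ` X) = card X" if "X \<subseteq> {1..d + 1}" for X
    using that by (intro card_image inj_on_subset[OF inj])
  from B have B': "B \<subseteq> {1..d + 1}" "card B = d div 2 + 1"
    "det (submatrix (DS_matrix d) UNIV (?p ` B)) \<noteq> 0" by (auto simp: DS_bases_def)
  from C have C': "C \<subseteq> {1..d + 1}" "card C = d div 2 + 1"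
    "det (submatrix (DS_matrix d) UNIV (?p ` C)) \<noteq> 0" by (auto simp: DS_bases_def)
  have diff: "?p ` X - ?p ` Y = ?p ` (X - Y)" if "X \<subseteq> {1..d + 1}" "Y \<subseteq> {1..d + 1}" for X Y
    using that inj_on_image_set_diff[OF inj, of X Y] by auto
  have "?p x \<in> ?p ` B - ?p ` C" using imageI[OF x, of ?p] by (simp only: diff[OF B'(1) C'(1)])
  then obtain z where z: "z \<in> ?p ` C - ?p ` B"
      "det (submatrix (DS_matrix d) UNIV (insert z (?p ` B - {?p x}))) \<noteq> 0"
    using maximal_minor_exchange[OF DS_matrix_carrier sub[OF B'(1)] _ B'(3) sub[OF C'(1)] _ C'(3)]
      card[OF B'(1)] card[OF C'(1)] B'(2) C'(2) by metis
  then obtain y where y: "y \<in> C - B" "z = ?p y" using diff[OF C'(1) B'(1)] by blast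
  have "{x} \<subseteq> {1..d + 1}" using B'(1) x by blast
  hence "?p ` B - {?p x} = ?p ` (B - {x})" using diff[of B "{x}"] B'(1) by simp
  hence "det (submatrix (DS_matrix d) UNIV (?p ` insert y (B - {x}))) \<noteq> 0"
    using z(2) y(2) by simp
  moreover have "finite B" using B'(1) finite_subset by blast
  hence "card (insert y (B - {x})) = d div 2 + 1"
    using card_exchange[of B x y] x y(1) B'(2) by simp
  moreover have "insert y (B - {x}) \<subseteq> {1..d + 1}" using B'(1) C'(1) y(1) by auto
  ultimately show ?thesis using y(1) unfolding DS_bases_def by blast
qed

lemma initial_DS_basis: "{1..d div 2 + 1} \<in> DS_bases d"
proof -
  let ?k = "d div 2 + 1" and ?p = "\<lambda>b :: nat. b - 1"
  have im: "?p ` {1..?k} = {..<?k}"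
  proof
    show "{..<?k} \<subseteq> ?p ` {1..?k}"
    proof
      fix i assume "i \<in> {..<?k}"
      thus "i \<in> ?p ` {1..?k}" by (intro image_eqI[of _ _ "Suc i"]) auto
    qed
  qed auto
  let ?S = "submatrix (DS_matrix d) UNIV {..<?k}"
  have cS: "?S \<in> carrier_mat ?k ?k"
    by (rule maximal_submatrix_carrier[OF DS_matrix_carrier]) auto
  have cols: "{j. j < d + 1 \<and> j < ?k} = {..<?k}" by auto
  have pick: "pick {..<?k} j = j" if "j < ?k" for j
  proof -
    have "{a \<in> {..<?k}. a < j} = {..<j}" using that by auto
    thus ?thesis using pick_card_in_set[of j "{..<?k}"] that by simp
  qed
  have S: "?S $$ (i, j) = of_nat ((d + 1 - i) choose (d + 1 - j)) - of_nat (i choose (d + 1 - j))"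
    if "i < ?k" "j < ?k" for i j
  proof -
    have "j < d + 1" using that(2) by linarith
    thus ?thesis using that pick[OF that(2)] cols
      by (simp add: submatrix_def DS_matrix_def pick_UNIV)
  qed
  have "upper_triangular ?S"
  proof
    fix i j assume "j < i" "i < dim_row ?S"
    hence ij: "j < i" "i < ?k" using cS by auto
    hence "i < d + 1 - j" "d + 1 - i < d + 1 - j" by linarith+
    hence "(d + 1 - i) choose (d + 1 - j) = 0" "i choose (d + 1 - j) = 0"
      by (simp_all only: binomial_eq_0)
    moreover have "j < ?k" using ij by linarith
    ultimately show "?S $$ (i, j) = 0" using ij(2) by (simp only: S of_nat_0 diff_self)
  qed
  hence det: "det ?S = prod_list (diag_mat ?S)" using cS by (rule det_upper_triangular)
  have "?S $$ (i, i) = 1" if "i < ?k" for i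
  proof -
    from that have "i < d + 1 - i" by linarith
    hence "i choose (d + 1 - i) = 0" by (simp only: binomial_eq_0)
    thus ?thesis using S[OF that that] by simp
  qed
  hence "diag_mat ?S = map (\<lambda>_. 1) [0..<?k]"
    unfolding diag_mat_def carrier_matD(1)[OF cS] by (intro map_cong refl) auto
  hence "det ?S = 1" by (simp only: det map_replicate_const prod_list_replicate power_one)
  hence "det (submatrix (DS_matrix d) UNIV (?p ` {1..?k})) \<noteq> 0" unfolding im by simp
  thus ?thesis unfolding DS_bases_def by auto
qed

lemma basis_system_DS: "basis_system {1..d + 1} (DS_bases d)"
proof (rule basis_systemI)
  show "DS_bases d \<noteq> {}" using initial_DS_basis by blast
  show "B \<subseteq> {1..d + 1}" if "B \<in> DS_bases d" for B using that by (simp add: DS_bases_def)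
qed (use DS_bases_exchange in auto)

lift_definition dehn_sommerville_matroid :: "nat \<Rightarrow> nat matroid" is
  "\<lambda>d. ({1..d + 1}, DS_bases d)"
  using basis_system_DS by simp

section \<open>The Catalan matroid\<close>

text \<open>A path of length \<open>2m\<close> is given by its sequence of lattice points \<open>p 0, \<dots>, p (2m)\<close>;
  the \<open>k\<close>-th step leads from \<open>p (k - 1)\<close> to \<open>p k\<close>.  The values of \<open>p\<close> beyond \<open>2m\<close> play no role.\<close>

definition upstep :: "(nat \<Rightarrow> int \<times> int) \<Rightarrow> nat \<Rightarrow> bool" where
  "upstep p k \<longleftrightarrow> p k = (fst (p (k - 1)) + 1, snd (p (k - 1)) + 1)"

definition downstep :: "(nat \<Rightarrow> int \<times> int) \<Rightarrow> nat \<Rightarrow> bool" where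
  "downstep p k \<longleftrightarrow> p k = (fst (p (k - 1)) + 1, snd (p (k - 1)) - 1)"

definition dyck_path :: "nat \<Rightarrow> (nat \<Rightarrow> int \<times> int) \<Rightarrow> bool" where
  "dyck_path m p \<longleftrightarrow> p 0 = (0, 0) \<and> p (2 * m) = (int (2 * m), 0) \<and>
     (\<forall>k\<in>{1..2 * m}. upstep p k \<or> downstep p k) \<and> (\<forall>k\<in>{0..2 * m}. snd (p k) \<ge> 0)"

definition upstep_set :: "nat \<Rightarrow> (nat \<Rightarrow> int \<times> int) \<Rightarrow> nat set" where
  "upstep_set m p = {k \<in> {1..2 * m}. upstep p k}"

definition catalan_bases :: "nat \<Rightarrow> nat set set" where
  "catalan_bases m = {upstep_set m p | p. dyck_path m p}"

lemma card_Int_atMost_Suc: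
  fixes B :: "nat set"
  shows "card (B \<inter> {1..Suc k}) = card (B \<inter> {1..k}) + (if Suc k \<in> B then 1 else 0)"
proof -
  have "B \<inter> {1..Suc k} = (if Suc k \<in> B then insert (Suc k) (B \<inter> {1..k}) else B \<inter> {1..k})"
    by (auto simp: le_Suc_eq)
  thus ?thesis by simp
qed

lemma catalan_bases_iff:
  "B \<in> catalan_bases m \<longleftrightarrow>
     B \<subseteq> {1..2 * m} \<and> card B = m \<and> (\<forall>k\<le>2 * m. k \<le> 2 * card (B \<inter> {1..k}))"
proof
  assume "B \<in> catalan_bases m"
  then obtain p where p: "dyck_path m p" "B = upstep_set m p" by (auto simp: catalan_bases_def)
  have height: "k \<le> 2 * m \<Longrightarrow> snd (p k) = 2 * int (card (B \<inter> {1..k})) - int k" for k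
  proof (induction k)
    case 0
    show ?case using p by (simp add: dyck_path_def)
  next
    case (Suc k)
    have "Suc k \<in> {1..2 * m}" using Suc.prems by auto
    hence "upstep p (Suc k) \<or> downstep p (Suc k)" using p by (auto simp: dyck_path_def)
    moreover have "Suc k \<in> B \<longleftrightarrow> upstep p (Suc k)" using p(2) Suc.prems by (auto simp: upstep_set_def)
    ultimately show ?case using Suc by (auto simp: card_Int_atMost_Suc[unfolded One_nat_def] upstep_def downstep_def)
  qed
  have sub: "B \<subseteq> {1..2 * m}" using p by (auto simp: upstep_set_def)
  hence int: "B \<inter> {1..2 * m} = B" by auto
  have "card B = m" using height[of "2 * m"] p(1) unfolding int by (simp add: dyck_path_def)
  moreover have "k \<le> 2 * card (B \<inter> {1..k})" if "k \<le> 2 * m" for k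
  proof -
    have "snd (p k) \<ge> 0" using p(1) that by (auto simp: dyck_path_def)
    thus ?thesis using height[OF that] by linarith
  qed
  ultimately show "B \<subseteq> {1..2 * m} \<and> card B = m \<and> (\<forall>k\<le>2 * m. k \<le> 2 * card (B \<inter> {1..k}))"
    using sub by blast
next
  assume B: "B \<subseteq> {1..2 * m} \<and> card B = m \<and> (\<forall>k\<le>2 * m. k \<le> 2 * card (B \<inter> {1..k}))"
  define p where "p = (\<lambda>k. (int k, 2 * int (card (B \<inter> {1..k})) - int k))"
  have int: "B \<inter> {1..2 * m} = B" using B by auto
  have step: "(upstep p k \<longleftrightarrow> k \<in> B) \<and> (downstep p k \<longleftrightarrow> k \<notin> B)" if k: "k \<in> {1..2 * m}" for k
  proof -
    obtain l where l: "k = Suc l" using k by (cases k) auto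
    show ?thesis unfolding l upstep_def downstep_def p_def
      by (auto simp: card_Int_atMost_Suc[unfolded One_nat_def])
  qed
  have "dyck_path m p"
    unfolding dyck_path_def
  proof (intro conjI ballI)
    show "p (2 * m) = (int (2 * m), 0)" unfolding p_def int using B by simp
  next
    fix k assume "k \<in> {0..2 * m}"
    hence "k \<le> 2 * card (B \<inter> {1..k})" using B by auto
    thus "0 \<le> snd (p k)" by (simp add: p_def)
  qed (use step in \<open>auto simp: p_def\<close>)
  moreover have "upstep_set m p = B" using step B by (auto simp: upstep_set_def)
  ultimately show "B \<in> catalan_bases m" unfolding catalan_bases_def by blast
qed

lemma catalan_bases_exchange:
  assumes A: "A \<in> catalan_bases m" and B: "B \<in> catalan_bases m" and x: "x \<in> A - B"
  shows "\<exists>y\<in>B - A. insert y (A - {x}) \<in> catalan_bases m"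
proof -
  note A' = A[unfolded catalan_bases_iff] and B' = B[unfolded catalan_bases_iff]
  have fin: "finite A" "finite B" using A' B' finite_subset by blast+
  have "B - A \<noteq> {}"
  proof
    assume "B - A = {}"
    hence "B = A" using A' B' fin by (intro card_subset_eq) auto
    thus False using x by simp
  qed
  define y where "y = Min (B - A)"
  have y: "y \<in> B - A" unfolding y_def using \<open>B - A \<noteq> {}\<close> fin by (intro Min_in) auto
  have ymin: "y \<le> z" if "z \<in> B - A" for z unfolding y_def using that fin by (intro Min_le) auto
  let ?C = "insert y (A - {x})"
  have "k \<le> 2 * card (?C \<inter> {1..k})" if k: "k \<le> 2 * m" for k
  proof (cases "x \<le> k \<and> k < y")
    case True
    hence "B \<inter> {1..k} \<subseteq> ?C \<inter> {1..k}" using x ymin by force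
    hence "card (B \<inter> {1..k}) \<le> card (?C \<inter> {1..k})" by (intro card_mono) auto
    thus ?thesis using B' k by (meson le_trans mult_le_mono2)
  next
    case False
    have "card (A \<inter> {1..k}) \<le> card (?C \<inter> {1..k})"
    proof (cases "x \<le> k")
      case True
      with False have "y \<le> k" by simp
      moreover have "y \<ge> 1" "x \<ge> 1" using y x A' B' by auto
      ultimately have "?C \<inter> {1..k} = insert y (A \<inter> {1..k} - {x})" "x \<in> A \<inter> {1..k}"
        using True x by auto
      moreover have "y \<notin> A \<inter> {1..k} - {x}" using y by auto
      ultimately show ?thesis using card_exchange[of "A \<inter> {1..k}" x y] y by simp
    next
      case False
      hence "A \<inter> {1..k} \<subseteq> ?C \<inter> {1..k}" by auto
      thus ?thesis by (intro card_mono) auto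
    qed
    thus ?thesis using A' k by (meson le_trans mult_le_mono2)
  qed
  moreover have "card ?C = m" using card_exchange[of A x y] fin x y A' by simp
  moreover have "?C \<subseteq> {1..2 * m}" using A' B' y by auto
  ultimately have "?C \<in> catalan_bases m" unfolding catalan_bases_iff by blast
  thus ?thesis using y by blast
qed

lemma initial_catalan_basis: "{1..m} \<in> catalan_bases m"
proof -
  have "k \<le> 2 * card ({1..m} \<inter> {1..k})" if "k \<le> 2 * m" for k
  proof -
    have "{1..m} \<inter> {1..k} = {1..min m k}" by auto
    thus ?thesis using that by simp
  qed
  thus ?thesis unfolding catalan_bases_iff by auto
qed

lemma basis_system_catalan: "basis_system {1..2 * m} (catalan_bases m)"
proof (rule basis_systemI)
  show "catalan_bases m \<noteq> {}" using initial_catalan_basis by blast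
  show "B \<subseteq> {1..2 * m}" if "B \<in> catalan_bases m" for B using that by (simp add: catalan_bases_iff)
qed (use catalan_bases_exchange in auto)

lift_definition catalan_matroid :: "nat \<Rightarrow> nat matroid" is
  "\<lambda>m. ({1..2 * m}, catalan_bases m)"
  using basis_system_catalan by simp

end

theory Submission
  imports Defs
begin

text \<open>
  In terms of \<open>z\<close>, the rows of the Dehn--Sommerville matrix are the coefficients of
  \<open>z ^ i * (1 + z) ^ (d + 1 - i) - z ^ (d + 1 - i) * (1 + z) ^ i\<close>. With \<open>w = z + z\<^sup>2\<close>, they span the
  polynomials in \<open>w\<close> of degree at most \<open>n\<close> if \<open>d = 2 * n\<close>, and the derivatives of these polynomials if
  \<open>d = 2 * n - 1\<close>; hence the matroid for \<open>2 * n - 1\<close> is a contraction of the one for \<open>2 * n\<close>. Since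
  \<open>w ^ (j + 1) = z * w ^ j + z\<^sup>2 * w ^ j\<close>, expanding a maximal minor of the matrix of the powers of
  \<open>w\<close> along its columns writes it as a sum of smaller such minors. So all these minors are
  nonnegative, and the minor with columns \<open>c 0 < c 1 < \<dots>\<close> is positive iff \<open>j \<le> c j \<le> 2 * j\<close>
  for all \<open>j\<close>, which is the condition that a path stays above the axis.
\<close>

section \<open>Column expansion and scaling of determinants\<close>

lemma det_mat_columns:
  "det (mat k k (\<lambda>(i, j). f i j)) =
    (\<Sum>p | p permutes {..<k}. signof p * (\<Prod>j<k. f (p j) j))"
proof -
  have "p j < k" if "p permutes {..<k}" "j < k" for p j
    using permutes_in_image[OF that(1), of j] that(2) by simp
  thus ?thesis
    by (subst det_col[of _ k]) (auto intro!: sum.cong prod.cong simp: lessThan_atLeast0)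
qed

text \<open>Distributing each product of the Leibniz formula amounts to choosing the set
  \<open>S\<close> of columns that take their entries from \<open>f\<close>.\<close>

lemma det_column_sum:
  fixes f g :: "nat \<Rightarrow> nat \<Rightarrow> 'a :: comm_ring_1"
  shows "det (mat k k (\<lambda>(i, j). f i j + g i j)) =
    (\<Sum>S\<in>Pow {..<k}. det (mat k k (\<lambda>(i, j). if j \<in> S then f i j else g i j)))"
proof -
  have expand: "(\<Prod>j<k. f (p j) j + g (p j) j) =
      (\<Sum>S\<in>Pow {..<k}. \<Prod>j<k. if j \<in> S then f (p j) j else g (p j) j)" for p
  proof -
    have "(\<Prod>j\<in>S. f (p j) j) * (\<Prod>j\<in>{..<k} - S. g (p j) j) =
        (\<Prod>j<k. if j \<in> S then f (p j) j else g (p j) j)" if "S \<subseteq> {..<k}" for S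
    proof -
      have "{..<k} \<inter> {j. j \<in> S} = S" "{..<k} \<inter> - {j. j \<in> S} = {..<k} - S" using that by auto
      thus ?thesis by (simp add: prod.If_cases)
    qed
    thus ?thesis by (simp add: prod_add)
  qed
  show ?thesis
    by (simp only: det_mat_columns expand sum_distrib_left) (rule sum.swap)
qed

lemma det_scale:
  fixes f :: "nat \<Rightarrow> nat \<Rightarrow> 'a :: comm_ring_1"
  shows "det (mat k k (\<lambda>(i, j). r i * s j * f i j)) =
    (\<Prod>i<k. r i) * (\<Prod>j<k. s j) * det (mat k k (\<lambda>(i, j). f i j))"
proof -
  have "(\<Prod>j<k. r (p j)) = (\<Prod>j<k. r j)" if "p permutes {..<k}" for p
    using prod.permute[OF that, of r] by (simp add: o_def)
  thus ?thesis
    unfolding det_mat_columns sum_distrib_left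
    by (intro sum.cong refl) (simp add: prod.distrib mult_ac)
qed

section \<open>Positivity of the minors of the powers of \<open>z + z ^ 2\<close>\<close>

text \<open>The coefficient of \<open>z ^ c\<close> in \<open>(z + z\<^sup>2) ^ j\<close>; integer indices spare the
  recursion its boundary cases.\<close>

primrec quad_coeff :: "nat \<Rightarrow> int \<Rightarrow> rat" where
  "quad_coeff 0 c = (if c = 0 then 1 else 0)"
| "quad_coeff (Suc j) c = quad_coeff j (c - 1) + quad_coeff j (c - 2)"

lemma quad_coeff_neg: "c < 0 \<Longrightarrow> quad_coeff j c = 0"
  by (induction j arbitrary: c) auto

text \<open>The columns are given by an arbitrary function \<open>c\<close>, so entries can be
  decreased freely; a repeated or negative index merely makes the minor vanish.\<close>

definition quad_minor :: "nat \<Rightarrow> (nat \<Rightarrow> int) \<Rightarrow> rat" where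
  "quad_minor k c = det (mat k k (\<lambda>(j, i). quad_coeff j (c i)))"

lemma quad_minor_expand:
  "det (mat k k (\<lambda>(j, i). quad_coeff (Suc j) (c i))) =
    (\<Sum>S\<in>Pow {..<k}. quad_minor k (\<lambda>i. c i - (if i \<in> S then 1 else 2)))"
proof -
  have "(if i \<in> S then quad_coeff j (c i - 1) else quad_coeff j (c i - 2)) =
      quad_coeff j (c i - (if i \<in> S then 1 else 2))" for i j S by simp
  thus ?thesis by (simp only: quad_coeff.simps det_column_sum quad_minor_def)
qed

text \<open>Row \<open>0\<close> holds the coefficients of the polynomial \<open>1\<close>, so its
  only nonzero entry is the first; Laplace expansion along it leaves the positive powers.\<close>

lemma quad_minor_Suc:
  assumes "c 0 = 0" "\<And>i. i < k \<Longrightarrow> c (Suc i) \<noteq> 0"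
  shows "quad_minor (Suc k) c = det (mat k k (\<lambda>(j, i). quad_coeff (Suc j) (c (Suc i))))"
proof -
  let ?A = "mat (Suc k) (Suc k) (\<lambda>(j, i). quad_coeff j (c i))"
  have "mat_delete ?A 0 0 = mat k k (\<lambda>(j, i). quad_coeff (Suc j) (c (Suc i)))"
    by (rule eq_matI) (auto simp: mat_delete_def)
  hence "cofactor ?A 0 0 = det (mat k k (\<lambda>(j, i). quad_coeff (Suc j) (c (Suc i))))"
    by (simp only: cofactor_def) simp
  moreover have "det ?A = (\<Sum>i<Suc k. ?A $$ (0, i) * cofactor ?A 0 i)"
    by (rule laplace_expansion_row) auto
  moreover have "(\<Sum>i<k. ?A $$ (0, Suc i) * cofactor ?A 0 (Suc i)) = 0"
    using assms(2) by (intro sum.neutral) simp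
  moreover have "?A $$ (0, 0) = 1" using assms(1) by simp
  ultimately show ?thesis
    unfolding quad_minor_def sum.lessThan_Suc_shift by (simp only: mult_1 add_0_right)
qed

lemma quad_minor_eq_0:
  assumes "i < k" "j < k" "i \<noteq> j" "c i = c j"
  shows "quad_minor k c = 0"
  unfolding quad_minor_def
  by (rule det_identical_columns[of _ k i j]) (use assms in \<open>auto intro!: eq_vecI\<close>)

lemma quad_minor_neg:
  assumes "0 < k" "c 0 < 0"
  shows "quad_minor k c = 0"
proof -
  have "det (mat k k (\<lambda>(j, i). quad_coeff j (c i))) = 
     (\<Sum>j<k. mat k k (\<lambda>(j, i). quad_coeff j (c i)) $$ (j, 0) *
        cofactor (mat k k (\<lambda>(j, i). quad_coeff j (c i))) j 0)"
    using assms by (intro laplace_expansion_column) auto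
  thus ?thesis using assms by (simp add: quad_minor_def quad_coeff_neg)
qed

lemma quad_minor_row_0:
  assumes "0 < k" "\<And>i. i < k \<Longrightarrow> c i \<noteq> 0"
  shows "quad_minor k c = 0"
proof -
  have "det (mat k k (\<lambda>(j, i). quad_coeff j (c i))) = 
     (\<Sum>i<k. mat k k (\<lambda>(j, i). quad_coeff j (c i)) $$ (0, i) *
        cofactor (mat k k (\<lambda>(j, i). quad_coeff j (c i))) 0 i)"
    using assms by (intro laplace_expansion_row) auto
  thus ?thesis using assms by (simp add: quad_minor_def)
qed

lemma strict_mono_ge:
  fixes c :: "nat \<Rightarrow> int"
  assumes "\<And>i j. i < j \<Longrightarrow> j < k \<Longrightarrow> c i < c j" "0 \<le> c 0" "i < k"
  shows "int i \<le> c i"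
  using assms(3)
proof (induction i)
  case (Suc i)
  thus ?case using assms(1)[of i "Suc i"] by simp
qed (use assms(2) in simp)

text \<open>Columns surviving the expansion are obtained from \<open>c 1, c 2, \<dots>\<close> by decreasing each entry by
  \<open>1\<close> or \<open>2\<close>. When \<open>j \<le> c j \<le> 2 * j\<close> for all \<open>j\<close>, decreasing by \<open>1\<close> exactly the entries
  with \<open>c j = j\<close> preserves these bounds.\<close>

lemma quad_minor_nonneg:
  assumes "\<And>i j. i < j \<Longrightarrow> j < k \<Longrightarrow> c i < c j"
  shows "0 \<le> quad_minor k c \<and>
    (0 < quad_minor k c \<longleftrightarrow> (\<forall>i<k. int i \<le> c i \<and> c i \<le> 2 * int i))"
  using assms
proof (induction k arbitrary: c)
  case 0
  show ?case by (simp add: quad_minor_def)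
next
  case (Suc k)
  note mono = Suc.prems
  show ?case
  proof (cases "c 0 = 0")
    case False
    \<comment> \<open>The bounds at \<open>i = 0\<close> force \<open>c 0 = 0\<close>. Otherwise the
      first column vanishes or, by monotonicity, all indices are positive and row \<open>0\<close>
      vanishes.\<close>
    have "quad_minor (Suc k) c = 0"
    proof (cases "c 0 < 0")
      case neg: False
      show ?thesis
      proof (rule quad_minor_row_0)
        fix i assume "i < Suc k"
        thus "c i \<noteq> 0" using False neg mono[of 0 i] by (cases "i = 0") auto
      qed simp
    qed (simp add: quad_minor_neg)
    thus ?thesis using False by auto
  next
    case True
    define b where "b = (\<lambda>S i. c (Suc i) - (if i \<in> S then 1 else 2 :: int))"
    have ge: "int i \<le> c i" if "i < Suc k" for i
      using strict_mono_ge[of "Suc k" c i] mono True that by simp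
    have "c (Suc i) \<noteq> 0" if "i < k" for i using ge[of "Suc i"] that by simp
    hence sum: "quad_minor (Suc k) c = (\<Sum>S\<in>Pow {..<k}. quad_minor k (b S))"
      unfolding b_def quad_minor_expand[of k "\<lambda>i. c (Suc i)", symmetric]
      by (rule quad_minor_Suc[of c k, OF True])
    \<comment> \<open>A strict gap shrinks by at most one, so \<open>b S\<close> either stays
      strictly increasing, where the induction hypothesis applies, or repeats a column.\<close>
    have weak: "b S i \<le> b S j" if "i < j" "j < k" for S i j
      using mono[of "Suc i" "Suc j"] that by (auto simp: b_def)
    have term_b: "0 \<le> quad_minor k (b S) \<and> (0 < quad_minor k (b S) \<longrightarrow>
        (\<forall>i<k. int i \<le> b S i \<and> b S i \<le> 2 * int i))" for S
    proof (cases "\<forall>i j. i < j \<longrightarrow> j < k \<longrightarrow> b S i < b S j")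
      case True
      thus ?thesis using Suc.IH[of "b S"] by blast
    next
      case False
      then obtain i j where ij: "i < j" "j < k" "\<not> b S i < b S j" by blast
      hence "b S i = b S j" using weak[of i j S] by simp
      hence "quad_minor k (b S) = 0" using ij by (intro quad_minor_eq_0[of i k j]) auto
      thus ?thesis by simp
    qed
    have nonneg: "0 \<le> quad_minor (Suc k) c" unfolding sum using term_b by (intro sum_nonneg) auto
    have "\<forall>i<Suc k. c i \<le> 2 * int i" if "0 < quad_minor (Suc k) c"
    proof -
      have "\<not> (\<forall>S\<in>Pow {..<k}. quad_minor k (b S) \<le> 0)"
      proof
        assume "\<forall>S\<in>Pow {..<k}. quad_minor k (b S) \<le> 0"
        hence "quad_minor (Suc k) c \<le> 0" unfolding sum by (intro sum_nonpos) blast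
        thus False using that by simp
      qed
      then obtain S where "0 < quad_minor k (b S)" by (auto simp: not_le)
      hence "b S i \<le> 2 * int i" if "i < k" for i using term_b[of S] that by blast
      moreover have "c (Suc i) \<le> b S i + 2" for i by (simp add: b_def)
      ultimately have "c (Suc i) \<le> 2 * int (Suc i)" if "i < k" for i
        using that by (fastforce intro: order_trans)
      thus ?thesis using True by (auto simp: less_Suc_eq_0_disj)
    qed
    moreover have "0 < quad_minor (Suc k) c" if le: "\<forall>i<Suc k. c i \<le> 2 * int i"
    proof -
      define S where "S = {i\<in>{..<k}. c (Suc i) = int (Suc i)}"
      have bd: "int i \<le> b S i \<and> b S i \<le> 2 * int i" if "i < k" for i
        using le[rule_format, of "Suc i"] ge[of "Suc i"] that by (auto simp: b_def S_def)
      \<comment> \<open>For \<open>i\<close> in \<open>S\<close> the entry equals \<open>i\<close>,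
        and the other is at least \<open>j\<close>. For \<open>i\<close> outside \<open>S\<close>
        the entry drops by the full \<open>2\<close>, the other by at most \<open>2\<close>.\<close>
      have "b S i < b S j" if "i < j" "j < k" for i j
      proof (cases "i \<in> S")
        case True
        hence "b S i = int i" by (simp add: b_def S_def)
        thus ?thesis using that bd[of j] by simp
      next
        case False
        hence "b S i = c (Suc i) - 2" by (simp add: b_def)
        thus ?thesis using mono[of "Suc i" "Suc j"] that by (auto simp: b_def)
      qed
      hence "0 < quad_minor k (b S)" using Suc.IH[of "b S"] bd by blast
      moreover have "S \<in> Pow {..<k}" by (auto simp: S_def)
      ultimately show ?thesis
        unfolding sum using term_b by (intro sum_pos2[where i = S]) auto
    qed
    ultimately show ?thesis using nonneg ge by blast
  qed
qed


section \<open>Row polynomials of the Dehn-Sommerville matrix\<close>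

abbreviation quad_poly :: "rat poly" where
  "quad_poly \<equiv> [:0, 1, 1:]"

lemma coeff_quad_power: "coeff (quad_poly ^ j) c = quad_coeff j (int c)"
proof (induction j arbitrary: c)
  case 0
  show ?case by simp
next
  case (Suc j)
  have "quad_poly ^ Suc j = pCons 0 (quad_poly ^ j + pCons 0 (quad_poly ^ j))" by simp
  also have "coeff \<dots> c = quad_coeff (Suc j) (int c)"
    by (auto simp: coeff_pCons Suc quad_coeff_neg algebra_simps split: nat.splits)
  finally show ?case .
qed

lemma coeff_binomial_power: "coeff ([:1, 1:] ^ n :: 'a :: comm_semiring_1 poly) i = of_nat (n choose i)"
proof (cases "i \<le> n")
  case False
  have "degree ([:1, 1:] ^ n :: 'a poly) \<le> n"
    using degree_power_le[of "[:1, 1:] :: 'a poly" n] by simp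
  thus ?thesis using False by (simp add: coeff_eq_0 binomial_eq_0)
qed (simp add: coeff_linear_poly_power)

text \<open>The cofactor left in a row polynomial once the common power of
  \<open>z * (1 + z)\<close> is taken out.\<close>

definition power_diff :: "nat \<Rightarrow> rat poly" where
  "power_diff e = [:1, 1:] ^ e - [:0, 1:] ^ e"

text \<open>With \<open>y = 1 + z\<close>, the recurrence has the characteristic roots
  \<open>y ^ 2\<close> and \<open>z ^ 2\<close>, with sum \<open>1 + 2 * quad_poly\<close> and
  product \<open>quad_poly ^ 2\<close>. Steps of two preserve the parity of
  \<open>e\<close>.\<close>

lemma power_diff_rec:
  "power_diff (e + 4) = (1 + 2 * quad_poly) * power_diff (e + 2) - quad_poly ^ 2 * power_diff e"
proof -
  have 1: "1 + 2 * quad_poly = [:1, 1:] ^ 2 + [:0, 1:] ^ 2" "quad_poly = [:1, 1:] * [:0, 1:]"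
    by (simp_all add: power2_eq_square numeral_poly one_pCons)
  have "(y ^ 2 + z ^ 2) * (y ^ (e + 2) - z ^ (e + 2)) - (y * z) ^ 2 * (y ^ e - z ^ e) =
      y ^ (e + 4) - z ^ (e + 4)" for y z :: "rat poly"
    by (simp add: power_add algebra_simps eval_nat_numeral)
  thus ?thesis unfolding power_diff_def 1(1) by (subst 1(2)) (rule sym)
qed

lemma pcompose_monom: "pcompose (monom a j) q = smult a (q ^ j)"
  for q :: "'a :: comm_ring_1 poly"
  by (induction j) (simp_all add: monom_0 monom_Suc pcompose_pCons)

text \<open>A polynomial changing sign under \<open>z \<mapsto> - 1 - z\<close> is divisible by \<open>1 + 2 * z\<close>, and the
  invariant ones are the polynomials in \<open>z + z\<^sup>2\<close>.\<close>

lemma power_diff_factor: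
  assumes "r \<in> {1, 2}"
  shows "\<exists>R. degree R \<le> m \<and> power_diff (2 * m + r) = power_diff r * pcompose R quad_poly"
proof (induction m rule: less_induct)
  case (less m)
  consider "m = 0" | "m = 1" | l where "m = l + 2" by (metis One_nat_def add_2_eq_Suc' not0_implies_Suc)
  thus ?case
  proof cases
    case 1
    thus ?thesis by (intro exI[of _ 1]) (simp add: pcompose_1)
  next
    case 2
    have "power_diff 3 = power_diff 1 * pcompose [:1, 3:] quad_poly"
      by (simp add: power_diff_def eval_nat_numeral pcompose_pCons)
    moreover have "power_diff 4 = power_diff 2 * pcompose [:1, 2:] quad_poly"
      by (simp add: power_diff_def eval_nat_numeral pcompose_pCons)
    ultimately have "\<exists>a. power_diff (2 + r) = power_diff r * pcompose [:1, a:] quad_poly"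
      using assms by (auto simp: eval_nat_numeral)
    then obtain a where "power_diff (2 + r) = power_diff r * pcompose [:1, a:] quad_poly" ..
    thus ?thesis using 2 by (intro exI[of _ "[:1, a:]"]) auto
  next
    case 3
    obtain R where R: "degree R \<le> l" "power_diff (2 * l + r) = power_diff r * pcompose R quad_poly"
      using less.IH[of l] 3 by auto
    obtain R' where R': "degree R' \<le> l + 1"
        "power_diff (2 * (l + 1) + r) = power_diff r * pcompose R' quad_poly"
      using less.IH[of "l + 1"] 3 by auto
    \<comment> \<open>The recurrence for \<open>power_diff\<close> with \<open>quad_poly\<close>
      replaced by the variable, so that the degree bound grows by one per step.\<close>
    let ?R = "[:1, 2:] * R' - monom 1 2 * R"
    have "degree ([:1, 2:] * R') \<le> m" "degree (monom 1 2 * R) \<le> m"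
      using R(1) R'(1) degree_mult_le[of "[:1, 2:]" R'] degree_mult_le[of "monom 1 2" R] 3
      by (auto simp: degree_monom_eq)
    hence deg: "degree ?R \<le> m" by (rule degree_diff_le)
    have "pcompose ?R quad_poly =
        (1 + 2 * quad_poly) * pcompose R' quad_poly - quad_poly ^ 2 * pcompose R quad_poly"
    proof -
      have "pcompose [:1, 2:] quad_poly = 1 + 2 * quad_poly"
        by (simp add: pcompose_pCons numeral_poly one_pCons)
      moreover have "pcompose (monom 1 2) quad_poly = quad_poly ^ 2"
        by (simp add: pcompose_monom)
      ultimately show ?thesis by (simp only: pcompose_diff pcompose_mult)
    qed
    moreover have "power_diff (2 * m + r) =
        (1 + 2 * quad_poly) * power_diff (2 * (l + 1) + r) - quad_poly ^ 2 * power_diff (2 * l + r)"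
    proof -
      have "2 * m + r = 2 * l + r + 4" "2 * (l + 1) + r = 2 * l + r + 2" using 3 by simp_all
      thus ?thesis by (simp only: power_diff_rec)
    qed
    ultimately have "power_diff (2 * m + r) = power_diff r * pcompose ?R quad_poly"
      unfolding R(2) R'(2) by (simp only: right_diff_distrib mult.left_commute)
    thus ?thesis using deg by blast
  qed
qed

section \<open>Change of basis in the row space\<close>

lemma pcompose_sum_coeffs:
  fixes p q :: "'a :: comm_ring_1 poly"
  assumes "degree p \<le> n"
  shows "pcompose p q = (\<Sum>j\<le>n. smult (coeff p j) (q ^ j))"
proof -
  have "pcompose p q = pcompose (\<Sum>j\<le>n. monom (coeff p j) j) q"
    using poly_as_sum_of_monoms'[OF assms] by simp
  thus ?thesis by (simp add: pcompose_sum pcompose_monom)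
qed

text \<open>Since \<open>power_diff 1\<close> is \<open>1\<close> and \<open>power_diff 2\<close> is
  \<open>1 + 2 * z\<close>, the derivative of \<open>quad_poly\<close>, the rows are powers of
  \<open>quad_poly\<close> for even \<open>d\<close> and scaled derivatives of its powers for odd
  \<open>d\<close>.\<close>

definition quad_matrix :: "nat \<Rightarrow> rat mat" where
  "quad_matrix d = mat (d div 2 + 1) (d + 1)
    (\<lambda>(j, c). coeff (power_diff (1 + d mod 2) * quad_poly ^ j) c)"

lemma quad_matrix_carrier: "quad_matrix d \<in> carrier_mat (d div 2 + 1) (d + 1)"
  by (simp add: quad_matrix_def)

lemma DS_matrix_row:
  assumes i: "i \<le> d div 2" and c: "c < d + 1"
  shows "DS_matrix d $$ (i, c) = coeff (quad_poly ^ i * power_diff (d + 1 - 2 * i)) c"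
proof -
  let ?z = "[:0, 1:] :: rat poly" and ?y = "[:1, 1:] :: rat poly"
  have split: "d + 1 - i = i + (d + 1 - 2 * i)" using i by linarith
  have q: "quad_poly = ?y * ?z" by simp
  have "quad_poly ^ i * power_diff (d + 1 - 2 * i) = ?z ^ i * ?y ^ (d + 1 - i) - ?z ^ (d + 1 - i) * ?y ^ i"
    unfolding split power_diff_def power_add q power_mult_distrib by (simp only: algebra_simps)
  also have "\<dots> = monom 1 i * ?y ^ (d + 1 - i) - monom 1 (d + 1 - i) * ?y ^ i"
    by (simp only: monom_altdef smult_1_left)
  also have "coeff \<dots> c = of_nat ((d + 1 - i) choose (d + 1 - c)) - of_nat (i choose (d + 1 - c))"
  proof -
    \<comment> \<open>Symmetry replaces the lower index \<open>c - a\<close> by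
      \<open>b - (c - a) = d + 1 - c\<close>; for \<open>c < a\<close> the latter exceeds
      \<open>b\<close>, and both sides vanish.\<close>
    have "(if c < a then 0 else of_nat (b choose (c - a))) = (of_nat (b choose (d + 1 - c)) :: rat)"
      if "a + b = d + 1" for a b
    proof (cases "c < a")
      case False
      hence "b choose (c - a) = b choose (b - (c - a))" using that c by (intro binomial_symmetric) linarith
      moreover have "b - (c - a) = d + 1 - c" using that False by linarith
      ultimately show ?thesis using False by simp
    qed (use that in \<open>simp add: binomial_eq_0\<close>)
    note choose = this
    have "i + (d + 1 - i) = d + 1" "d + 1 - i + i = d + 1" using i by linarith+
    thus ?thesis
      by (simp only: coeff_diff coeff_monom_mult coeff_binomial_power mult_1 choose)
  qed
  finally show ?thesis using i c by (simp add: DS_matrix_def)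
qed

text \<open>Each row polynomial is the common factor times a polynomial in \<open>quad_poly\<close>
  of degree at most \<open>d div 2\<close>, whose coefficients form a row of
  \<open>T\<close>.\<close>

lemma DS_matrix_factor:
  obtains T where "T \<in> carrier_mat (d div 2 + 1) (d div 2 + 1)" "DS_matrix d = T * quad_matrix d"
proof -
  let ?k = "d div 2 + 1" and ?r = "1 + d mod 2"
  have "\<exists>Q. degree Q \<le> d div 2 \<and>
      quad_poly ^ i * power_diff (d + 1 - 2 * i) = power_diff ?r * pcompose Q quad_poly"
    if i: "i \<le> d div 2" for i
  proof -
    have "?r \<in> {1, 2}" by auto
    then obtain R where R: "degree R \<le> d div 2 - i"
        "power_diff (2 * (d div 2 - i) + ?r) = power_diff ?r * pcompose R quad_poly"
      using power_diff_factor by blast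
    have "2 * (d div 2 - i) + ?r = d + 1 - 2 * i" using i by presburger
    hence "quad_poly ^ i * power_diff (d + 1 - 2 * i) =
        power_diff ?r * pcompose (monom 1 i * R) quad_poly"
      using R(2) by (simp add: pcompose_monom pcompose_mult)
    moreover have "degree (monom 1 i * R) \<le> d div 2"
      using degree_mult_le[of "monom 1 i" R] R(1) i by (simp add: degree_monom_eq)
    ultimately show ?thesis by blast
  qed
  then obtain Q where Q: "\<And>i. i \<le> d div 2 \<Longrightarrow> degree (Q i) \<le> d div 2"
      "\<And>i. i \<le> d div 2 \<Longrightarrow>
        quad_poly ^ i * power_diff (d + 1 - 2 * i) = power_diff ?r * pcompose (Q i) quad_poly"
    by metis
  define T where "T = mat ?k ?k (\<lambda>(i, j). coeff (Q i) j)"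
  have T: "T \<in> carrier_mat ?k ?k" by (simp add: T_def)
  have "DS_matrix d = T * quad_matrix d"
  proof (rule eq_matI)
    fix i c assume "i < dim_row (T * quad_matrix d)" "c < dim_col (T * quad_matrix d)"
    hence ic: "i < ?k" "c < d + 1" by (simp_all add: T_def quad_matrix_def)
    hence "DS_matrix d $$ (i, c) = coeff (power_diff ?r * pcompose (Q i) quad_poly) c"
      using DS_matrix_row[of i d c] Q(2)[of i] by simp
    also have "\<dots> = (\<Sum>j\<le>d div 2. coeff (Q i) j * coeff (power_diff ?r * quad_poly ^ j) c)"
      using Q(1)[of i] ic by (simp add: pcompose_sum_coeffs sum_distrib_left coeff_sum)
    also have "\<dots> = (T * quad_matrix d) $$ (i, c)"
      using ic by (simp add: T_def quad_matrix_def scalar_prod_def atLeast0LessThan lessThan_Suc_atMost)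
    finally show "DS_matrix d $$ (i, c) = (T * quad_matrix d) $$ (i, c)" .
  qed (simp_all add: T_def quad_matrix_def DS_matrix_def)
  thus thesis using that T by blast
qed

section \<open>Nonvanishing of the maximal minors\<close>

lemma submatrix_columns_eq:
  assumes "A \<in> carrier_mat k n" "J \<subseteq> {..<n}" "card J = k"
  shows "submatrix A UNIV J = mat k k (\<lambda>(i, j). A $$ (i, pick J j))"
proof -
  have "{j. j < n \<and> j \<in> J} = J" using assms(2) by auto
  thus ?thesis using assms by (auto simp: submatrix_def pick_UNIV)
qed

lemma det_submatrix_mult:
  fixes N :: "'a :: comm_ring_1 mat"
  assumes T: "T \<in> carrier_mat k k" and N: "N \<in> carrier_mat k n"
    and J: "J \<subseteq> {..<n}" "card J = k"
  shows "det (submatrix (T * N) UNIV J) = det T * det (submatrix N UNIV J)"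
proof -
  have pick: "pick J j < n" if "j < k" for j using pick_in_set_le[of j J] J that by auto
  have "submatrix (T * N) UNIV J = T * submatrix N UNIV J"
    using T N J pick
    by (intro eq_matI) (auto simp: submatrix_columns_eq[of _ k n] scalar_prod_def)
  moreover have "submatrix N UNIV J \<in> carrier_mat k k"
    using submatrix_columns_eq[OF N J] by simp
  ultimately show ?thesis using T by (simp add: det_mult)
qed

lemma inj_on_pred:
  fixes B :: "nat set"
  assumes "0 \<notin> B"
  shows "inj_on (\<lambda>b. b - 1) B"
proof (rule inj_onI)
  fix x y assume *: "x \<in> B" "y \<in> B" "x - 1 = y - 1"
  hence "x \<noteq> 0" "y \<noteq> 0" using assms by metis+
  thus "x = y" using *(3) by simp
qed

lemma DS_bases_quad_matrix:
  assumes "B \<subseteq> {1..d + 1}" "card B = d div 2 + 1"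
  shows "B \<in> DS_bases d \<longleftrightarrow> det (submatrix (quad_matrix d) UNIV ((\<lambda>b. b - 1) ` B)) \<noteq> 0"
proof -
  let ?p = "\<lambda>b :: nat. b - 1" and ?k = "d div 2 + 1"
  obtain T where T: "T \<in> carrier_mat ?k ?k" "DS_matrix d = T * quad_matrix d"
    using DS_matrix_factor .
  have det: "det (submatrix (DS_matrix d) UNIV (?p ` X)) =
      det T * det (submatrix (quad_matrix d) UNIV (?p ` X))"
    if "X \<subseteq> {1..d + 1}" "card X = ?k" for X
  proof -
    have "inj_on ?p X" using that(1) by (intro inj_on_pred) auto
    hence "card (?p ` X) = ?k" using that(2) by (simp add: card_image)
    moreover have "?p ` X \<subseteq> {..<d + 1}" using that(1) by force
    ultimately show ?thesis
      unfolding T(2) by (intro det_submatrix_mult[OF T(1) quad_matrix_carrier])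
  qed
  \<comment> \<open>One known nonzero maximal minor of \<open>DS_matrix d\<close> makes
    \<open>T\<close> invertible, without computing it.\<close>
  have "det T \<noteq> 0" using initial_DS_basis[of d] det[of "{1..?k}"] by (auto simp: DS_bases_def)
  thus ?thesis using assms det[OF assms] by (simp add: DS_bases_def)
qed

text \<open>The common factor is \<open>1\<close>, so this is a \<open>quad_minor\<close>; the lower
  bounds hold for any increasing nonnegative sequence.\<close>

lemma det_quad_matrix_even:
  assumes J: "J \<subseteq> {..<2 * n + 1}" "card J = n + 1"
  shows "det (submatrix (quad_matrix (2 * n)) UNIV J) \<noteq> 0 \<longleftrightarrow> (\<forall>i\<le>n. pick J i \<le> 2 * i)"
proof -
  have pick: "pick J i < 2 * n + 1" if "i < n + 1" for i using pick_in_set_le[of i J] J that by auto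
  have mono: "int (pick J i) < int (pick J j)" if "i < j" "j < n + 1" for i j
    using pick_mono_le[of j J i] that J by simp
  have 1: "power_diff 1 = 1" by (simp add: power_diff_def one_pCons)
  have "submatrix (quad_matrix (2 * n)) UNIV J =
      mat (n + 1) (n + 1) (\<lambda>(j, i). quad_coeff j (int (pick J i)))"
    using J pick quad_matrix_carrier[of "2 * n"]
    by (subst submatrix_columns_eq[of _ "n + 1" "2 * n + 1"])
       (auto intro!: eq_matI simp: quad_matrix_def 1[unfolded One_nat_def] coeff_quad_power)
  hence "det (submatrix (quad_matrix (2 * n)) UNIV J) = quad_minor (n + 1) (\<lambda>i. int (pick J i))"
    by (simp add: quad_minor_def)
  thus ?thesis
    using quad_minor_nonneg[of "n + 1" "\<lambda>i. int (pick J i)", OF mono]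
      strict_mono_ge[of "n + 1" "\<lambda>i. int (pick J i)", OF mono]
    by (auto simp: less_Suc_eq_le)
qed

text \<open>Row \<open>j\<close> is the derivative of \<open>quad_poly ^ Suc j\<close> divided by
  \<open>Suc j\<close>. Up to nonzero row and column factors, the minor is thus what expansion along
  row \<open>0\<close> leaves of a larger \<open>quad_minor\<close>.\<close>

lemma det_quad_matrix_odd:
  assumes J: "J \<subseteq> {..<2 * n + 2}" "card J = n + 1"
  shows "det (submatrix (quad_matrix (2 * n + 1)) UNIV J) \<noteq> 0 \<longleftrightarrow> (\<forall>i\<le>n. pick J i \<le> 2 * i + 1)"
proof -
  \<comment> \<open>Column \<open>0\<close> is put in front, and the chosen columns move up by one
    to undo the index shift of differentiation.\<close>
  let ?c = "\<lambda>i. case i of 0 \<Rightarrow> 0 | Suc i \<Rightarrow> 1 + int (pick J i)"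
  have pick: "pick J i < 2 * n + 2" if "i < n + 1" for i using pick_in_set_le[of i J] J that by auto
  have mono: "?c i < ?c j" if "i < j" "j < n + 2" for i j
    using pick_mono_le[of "j - 1" J "i - 1"] that J by (auto split: nat.splits)
  have "pderiv quad_poly = power_diff 2"
    by (simp add: pderiv_pCons power_diff_def power2_eq_square)
  hence pderiv: "pderiv (quad_poly ^ Suc j) = smult (of_nat (Suc j)) (power_diff 2 * quad_poly ^ j)" for j
    by (simp only: pderiv_power_Suc mult_smult_left mult.commute[of "power_diff 2"])
  have coeff: "coeff (power_diff 2 * quad_poly ^ j) c =
      1 / of_nat (Suc j) * of_nat (Suc c) * quad_coeff (Suc j) (int (Suc c))" for j c
  proof -
    have "of_nat (Suc j) * coeff (power_diff 2 * quad_poly ^ j) c =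
        of_nat (Suc c) * quad_coeff (Suc j) (int (Suc c))"
      using arg_cong[OF pderiv[of j], of "\<lambda>p. coeff p c"]
      by (simp only: coeff_pderiv coeff_smult coeff_quad_power)
    moreover have "of_nat (Suc j) \<noteq> (0 :: rat)" by (simp only: of_nat_eq_0_iff nat.distinct simp_thms)
    moreover have "x = 1 / a * b * y" if "a * x = b * y" "a \<noteq> 0" for a b x y :: rat
      using that by (simp add: field_simps)
    ultimately show ?thesis by blast
  qed
  let ?A = "mat (n + 1) (n + 1) (\<lambda>(j, i). quad_coeff (Suc j) (int (Suc (pick J i))))"
  have "submatrix (quad_matrix (2 * n + 1)) UNIV J = mat (n + 1) (n + 1)
      (\<lambda>(j, i). 1 / of_nat (Suc j) * of_nat (Suc (pick J i)) * quad_coeff (Suc j) (int (Suc (pick J i))))"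
    using J pick quad_matrix_carrier[of "2 * n + 1"]
    by (subst submatrix_columns_eq[of _ "n + 1" "2 * n + 2"])
       (auto intro!: eq_matI simp: quad_matrix_def coeff[unfolded numeral_2_eq_2] simp del: of_nat_Suc quad_coeff.simps)
  hence "det (submatrix (quad_matrix (2 * n + 1)) UNIV J) =
      (\<Prod>j<n + 1. 1 / of_nat (Suc j)) * (\<Prod>i<n + 1. of_nat (Suc (pick J i))) * det ?A"
    by (simp only: det_scale)
  moreover have "(\<Prod>j<n + 1. 1 / of_nat (Suc j) :: rat) \<noteq> 0"
    "(\<Prod>i<n + 1. of_nat (Suc (pick J i)) :: rat) \<noteq> 0" by (simp_all del: of_nat_Suc)
  moreover have "quad_minor (n + 2) ?c = det ?A"
    using quad_minor_Suc[of ?c "n + 1"] by (simp del: quad_coeff.simps)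
  ultimately have "det (submatrix (quad_matrix (2 * n + 1)) UNIV J) \<noteq> 0 \<longleftrightarrow> quad_minor (n + 2) ?c \<noteq> 0"
    by simp
  also have "\<dots> \<longleftrightarrow> 0 < quad_minor (n + 2) ?c" using quad_minor_nonneg[of "n + 2" ?c, OF mono] by auto
  also have "\<dots> \<longleftrightarrow> (\<forall>i<n + 2. ?c i \<le> 2 * int i)"
    using quad_minor_nonneg[of "n + 2" ?c, OF mono] strict_mono_ge[of "n + 2" ?c, OF mono] by auto
  also have "\<dots> \<longleftrightarrow> (\<forall>i\<le>n. ?c (Suc i) \<le> 2 * int (Suc i))"
    by (auto simp: less_Suc_eq_le split: nat.splits)
  also have "\<dots> \<longleftrightarrow> (\<forall>i\<le>n. pick J i \<le> 2 * i + 1)" by auto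
  finally show ?thesis .
qed

section \<open>Ballot form of the basis condition\<close>

lemma pick_le_iff_ballot:
  assumes J: "J \<subseteq> {..<2 * k + r}" "card J = k"
  shows "(\<forall>i<k. pick J i \<le> 2 * i + r) \<longleftrightarrow>
    (\<forall>m\<le>2 * k + r. m \<le> 2 * card {a \<in> J. a < m} + r)"
proof (intro iffI allI impI)
  fix i assume *: "\<forall>m\<le>2 * k + r. m \<le> 2 * card {a \<in> J. a < m} + r" "i < k"
  have "pick J i \<le> 2 * k + r" using pick_in_set_le[of i J] J *(2) by auto
  \<comment> \<open>Take \<open>m = pick J i\<close>: exactly \<open>i\<close> elements of
    \<open>J\<close> lie below it.\<close>
  thus "pick J i \<le> 2 * i + r" using *(1) card_pick_le[of i J] J(2) *(2) by metis
next
  fix m assume *: "\<forall>i<k. pick J i \<le> 2 * i + r" "m \<le> 2 * k + r"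
  let ?t = "card {a \<in> J. a < m}"
  show "m \<le> 2 * ?t + r"
  proof (cases "?t < k")
    case True
    \<comment> \<open>The element of rank \<open>?t\<close> is the first one not counted, hence at
      least \<open>m\<close>.\<close>
    have "m \<le> pick J ?t"
    proof (rule ccontr)
      assume "\<not> m \<le> pick J ?t"
      hence "insert (pick J ?t) {a \<in> J. a < pick J ?t} \<subseteq> {a \<in> J. a < m}"
        using pick_in_set_le[of ?t J] True J(2) by auto
      hence "card (insert (pick J ?t) {a \<in> J. a < pick J ?t}) \<le> ?t"
        by (intro card_mono) auto
      thus False using card_pick_le[of ?t J] True J(2) by simp
    qed
    thus ?thesis using *(1) True le_trans by blast
  qed (use *(2) in linarith)
qed

lemma card_pred_image:
  fixes B :: "nat set"
  assumes "0 \<notin> B"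
  shows "card {a \<in> (\<lambda>b. b - 1) ` B. a < m} = card (B \<inter> {1..m})"
proof -
  have "{a \<in> (\<lambda>b. b - 1) ` B. a < m} = (\<lambda>b. b - 1) ` (B \<inter> {1..m})"
  proof -
    have "b - 1 < m \<longleftrightarrow> b \<in> {1..m}" if "b \<in> B" for b using assms that by (cases b) auto
    thus ?thesis by blast
  qed
  moreover have "inj_on (\<lambda>b. b - 1) (B \<inter> {1..m})" by (rule inj_on_pred) simp
  ultimately show ?thesis by (simp add: card_image)
qed

text \<open>Reading \<open>B\<close> as an upstep set, the path starts at height
  \<open>d mod 2\<close>, stays nonnegative and ends at height zero after \<open>d + 2\<close>
  steps.\<close>

lemma DS_bases_ballot:
  assumes B: "B \<subseteq> {1..d + 1}"
  shows "B \<in> DS_bases d \<longleftrightarrow> card B = d div 2 + 1 \<and>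
    (\<forall>m\<le>d + 2. m \<le> 2 * card (B \<inter> {1..m}) + d mod 2)"
proof (cases "card B = d div 2 + 1")
  case True
  let ?J = "(\<lambda>b. b - 1) ` B" and ?k = "d div 2 + 1"
  have "inj_on (\<lambda>b. b - 1) B" using B by (intro inj_on_pred) auto
  hence J: "?J \<subseteq> {..<d + 1}" "card ?J = ?k" using B True by (force, simp add: card_image)
  have "0 \<notin> B" using B by auto
  have "det (submatrix (quad_matrix d) UNIV ?J) \<noteq> 0 \<longleftrightarrow> (\<forall>i<?k. pick ?J i \<le> 2 * i + d mod 2)"
  proof (cases "even d")
    case True
    then obtain n where "d = 2 * n" by blast
    thus ?thesis using det_quad_matrix_even[of ?J n] J by (auto simp: less_Suc_eq_le)
  next
    case False
    then obtain n where "d = 2 * n + 1" by (rule oddE)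
    thus ?thesis using det_quad_matrix_odd[of ?J n] J by (auto simp: less_Suc_eq_le)
  qed
  also have "\<dots> \<longleftrightarrow> (\<forall>m\<le>2 * ?k + d mod 2. m \<le> 2 * card {a \<in> ?J. a < m} + d mod 2)"
    using J by (intro pick_le_iff_ballot) auto
  also have "2 * ?k + d mod 2 = d + 2" by simp
  finally show ?thesis
    using DS_bases_quad_matrix[OF B True] True card_pred_image[OF \<open>0 \<notin> B\<close>] by simp
qed (simp add: DS_bases_def)

section \<open>Loops, coloops and the isomorphisms\<close>

lemma ground_catalan: "ground (catalan_matroid m) = {1..2 * m}"
  by transfer simp

lemma bases_catalan: "bases (catalan_matroid m) = catalan_bases m"
  by transfer simp

lemma ground_DS: "ground (dehn_sommerville_matroid d) = {1..d + 1}"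
  by transfer simp

lemma bases_DS: "bases (dehn_sommerville_matroid d) = DS_bases d"
  by transfer simp

lemma catalan_coloop: "is_coloop (catalan_matroid (n + 1)) 1"
proof -
  have "1 \<in> B" if "B \<in> catalan_bases (n + 1)" for B
  proof -
    have "1 \<le> 2 * card (B \<inter> {1..1})" using that unfolding catalan_bases_iff by fastforce
    thus ?thesis by (cases "1 \<in> B") auto
  qed
  thus ?thesis by (auto simp: is_coloop_def ground_catalan bases_catalan)
qed

text \<open>The prefix of odd length \<open>2 * n + 1\<close> must contain at least
  \<open>n + 1\<close> upsteps, hence all of them.\<close>

lemma catalan_loop: "is_loop (catalan_matroid (n + 1)) (2 * n + 2)"
proof -
  have "2 * n + 2 \<notin> B" if B: "B \<in> catalan_bases (n + 1)" for B
  proof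
    assume mem: "2 * n + 2 \<in> B"
    have B': "B \<subseteq> {1..2 * n + 2}" "card B = n + 1" "2 * n + 1 \<le> 2 * card (B \<inter> {1..2 * n + 1})"
      using B unfolding catalan_bases_iff by auto
    have "finite B" using B'(1) finite_subset by blast
    moreover have "2 * n + 2 \<notin> {1..2 * n + 1}" by simp
    hence "B \<inter> {1..2 * n + 1} \<subset> B" using mem by blast
    ultimately have "card (B \<inter> {1..2 * n + 1}) < card B" by (rule psubset_card_mono)
    thus False using B'(2,3) by linarith
  qed
  thus ?thesis by (auto simp: is_loop_def ground_catalan bases_catalan)
qed

lemma bases_delete_loop:
  assumes "is_loop M e"
  shows "bases (deletion M e) = bases M"
proof -
  have "\<not> is_coloop M e"
    using assms basis_systemD(2)[OF basis_system_matroid[of M]]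
    by (auto simp: is_loop_def is_coloop_def)
  thus ?thesis using assms by (auto simp: bases_deletion is_loop_def)
qed

lemma loop_deletion:
  assumes "is_loop M e" "e \<noteq> f"
  shows "is_loop (deletion M f) e"
  using assms by (auto simp: is_loop_def ground_deletion bases_deletion)

lemma DS_even_catalan:
  assumes B: "B \<subseteq> {1..2 * n + 1}"
  shows "B \<in> DS_bases (2 * n) \<longleftrightarrow> B \<in> catalan_bases (n + 1)"
proof -
  have "B \<subseteq> {1..2 * (n + 1)}" using B by auto
  thus ?thesis using DS_bases_ballot[of B "2 * n"] B unfolding catalan_bases_iff by simp
qed

text \<open>A prepended upstep supplies the starting height one, since
  \<open>m \<le> 2 * t + 1\<close> is the same as \<open>Suc m \<le> 2 * Suc t\<close>.\<close>

lemma DS_odd_catalan: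
  assumes B: "B \<subseteq> {1..2 * n + 2}"
  shows "B \<in> DS_bases (2 * n + 1) \<longleftrightarrow> insert 1 (Suc ` B) \<in> catalan_bases (n + 2)"
proof -
  let ?C = "insert 1 (Suc ` B)"
  have fin: "finite B" using B finite_subset by blast
  have "1 \<notin> Suc ` B" using B by auto
  have sub: "?C \<subseteq> {1..2 * (n + 2)}" using B by auto
  have card: "card ?C = Suc (card B)"
    using fin \<open>1 \<notin> Suc ` B\<close> by (simp add: card_image)
  have Int: "card (?C \<inter> {1..Suc m}) = Suc (card (B \<inter> {1..m}))" for m
  proof -
    have "?C \<inter> {1..Suc m} = insert 1 (Suc ` (B \<inter> {1..m}))" using B by auto
    moreover have "1 \<notin> Suc ` (B \<inter> {1..m})" by auto
    ultimately show ?thesis by (simp add: card_image)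
  qed
  have "(\<forall>k\<le>2 * (n + 2). k \<le> 2 * card (?C \<inter> {1..k})) \<longleftrightarrow>
      (\<forall>m\<le>2 * n + 3. Suc m \<le> 2 * card (?C \<inter> {1..Suc m}))"
    (is "?L \<longleftrightarrow> ?R")
  proof (intro iffI allI impI)
    fix k assume "?R" "k \<le> 2 * (n + 2)"
    thus "k \<le> 2 * card (?C \<inter> {1..k})" by (cases k) auto
  next
    fix m assume "?L" "m \<le> 2 * n + 3"
    moreover from this(2) have "Suc m \<le> 2 * (n + 2)" by simp
    ultimately show "Suc m \<le> 2 * card (?C \<inter> {1..Suc m})" by blast
  qed
  thus ?thesis
    using DS_bases_ballot[of B "2 * n + 1"] B sub unfolding catalan_bases_iff Int card
    by (simp add: numeral_3_eq_3)
qed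

theorem theorem3p1:
  fixes n :: nat
  shows "is_coloop (catalan_matroid (n + 1)) 1
    \<and> is_loop (catalan_matroid (n + 1)) (2 * n + 2)
    \<and> dehn_sommerville_matroid (2 * n) \<cong>\<^sub>M deletion (catalan_matroid (n + 1)) (2 * n + 2)
    \<and> (n \<ge> 1 \<longrightarrow> dehn_sommerville_matroid (2 * n - 1)
         \<cong>\<^sub>M deletion (deletion (catalan_matroid (n + 1)) 1) (2 * n + 2))"
proof (intro conjI impI)
  let ?C = "catalan_matroid (n + 1)" and ?e = "2 * n + 2"
  show "is_coloop ?C 1" by (rule catalan_coloop)
  show "is_loop ?C ?e" by (rule catalan_loop)
  show "dehn_sommerville_matroid (2 * n) \<cong>\<^sub>M deletion ?C ?e"
    unfolding matroid_iso_def ground_deletion ground_catalan ground_DS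
      bases_delete_loop[OF catalan_loop] bases_catalan bases_DS
  proof (intro exI[of _ id] conjI allI impI)
    have "{1..2 * n + 1} = {1..2 * (n + 1)} - {?e}" by auto
    thus "bij_betw id {1..2 * n + 1} ({1..2 * (n + 1)} - {?e})" by (simp add: bij_betw_id_iff)
  qed (simp add: DS_even_catalan)
  assume "n \<ge> 1"
  then obtain l where l: "n = l + 1" using le_iff_add by (metis add.commute)
  have loop: "is_loop (deletion ?C 1) ?e" by (intro loop_deletion catalan_loop) simp
  show "dehn_sommerville_matroid (2 * n - 1) \<cong>\<^sub>M deletion (deletion ?C 1) ?e"
    unfolding matroid_iso_def
  proof (intro exI[of _ Suc] conjI allI impI)
    have "Suc ` {1..2 * n} = {1..2 * (n + 1)} - {1} - {?e}"
      by (auto simp: image_Suc_atLeastAtMost)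
    thus "bij_betw Suc (ground (dehn_sommerville_matroid (2 * n - 1)))
        (ground (deletion (deletion ?C 1) ?e))"
      using l by (simp add: bij_betw_def ground_deletion ground_catalan ground_DS)
  next
    fix B assume "B \<subseteq> ground (dehn_sommerville_matroid (2 * n - 1))"
    hence B: "B \<subseteq> {1..2 * l + 2}" by (simp add: ground_DS l)
    have "1 \<notin> Suc ` B" using B by auto
    \<comment> \<open>Every Catalan basis contains \<open>1\<close>, so inserting \<open>1\<close>
      undoes its removal.\<close>
    have "Suc ` B \<in> (\<lambda>X. X - {1}) ` catalan_bases (n + 1) \<longleftrightarrow>
        insert 1 (Suc ` B) \<in> catalan_bases (n + 1)"
    proof
      assume "Suc ` B \<in> (\<lambda>X. X - {1}) ` catalan_bases (n + 1)"
      then obtain X where X: "X \<in> catalan_bases (n + 1)" "Suc ` B = X - {1}" by blast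
      moreover have "1 \<in> X"
        using catalan_coloop[of n] X(1) by (simp add: is_coloop_def bases_catalan)
      ultimately show "insert 1 (Suc ` B) \<in> catalan_bases (n + 1)" by (simp add: insert_absorb)
    next
      assume "insert 1 (Suc ` B) \<in> catalan_bases (n + 1)"
      thus "Suc ` B \<in> (\<lambda>X. X - {1}) ` catalan_bases (n + 1)"
        using \<open>1 \<notin> Suc ` B\<close> by (intro image_eqI[of _ _ "insert 1 (Suc ` B)"]) auto
    qed
    moreover have "bases (deletion (deletion ?C 1) ?e) = (\<lambda>X. X - {1}) ` catalan_bases (n + 1)"
      by (simp only: bases_delete_loop[OF loop] bases_deletion[of ?C 1] catalan_coloop
          bases_catalan if_True)
    moreover have "2 * n - 1 = 2 * l + 1" "n + 1 = l + 2" using l by simp_all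
    ultimately show "B \<in> bases (dehn_sommerville_matroid (2 * n - 1)) \<longleftrightarrow>
        Suc ` B \<in> bases (deletion (deletion ?C 1) ?e)"
      using DS_odd_catalan[OF B] by (simp only: bases_DS)
  qed
qed

end
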